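(* The category $\mathrm{DVect}$ of diffeological vector spaces and smooth linear maps is complete, i.e. it has all small limits.
   Context: A diffeological space is a set $X$ together with a specified set of functions $U\to X$ (called plots), for every open set $U\subseteq\mathbb{R}^n$ and every $n\in\mathbb{N}=\{0,1,2,\dots\}$, such that: (1) every constant map $U\to X$ is a plot; (2) if $U\to X$ is a plot and $V\to U$ is a smooth map between open subsets of Euclidean spaces, then $V\to U\to X$ is a plot; (3) if $U=\bigcup_i U_i$ is an open cover and $U\to X$ is a map whose restrictions to all $U_i$ are plots, then $U\to X$ is a plot. A map between diffeological spaces is smooth if composing with it sends plots to plots. Products carry the product diffeology (a map into a product is a plot iff all its components are plots), and $\mathbb{R}$ carries the standard diffeology (plots are the usual smooth functions). A diffeological vector space is a real vector space $V$ with a diffeology such that addition $V\times V\to V$ and scalar multiplication $\mathbb{R}\times V\to V$ are smooth. $\mathrm{DVect}$ is the category of diffeological vector spaces and maps that are both smooth and linear. *)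

theory Defs
  imports
    "HOL-Analysis.Abstract_Euclidean_Space"
    "HOL-Analysis.Derivative"
    "HOL-Algebra.Algebraic_Closure_Type"
begin

section \<open>Smooth maps between open subsets of Euclidean spaces\<close>

text \<open>
  The dimension varies inside the definition of a diffeology, so the \<open>n\<close>-dimensional space is the
  library's \<^const>\<open>Euclidean_space\<close> \<open>n\<close>: the sequences of reals that vanish from index \<open>n\<close> on.
  \<open>C_diff k n U f\<close> says that the partial derivatives of \<open>f\<close> of order up to \<open>k\<close>
  exist and are continuous on the open set \<open>U\<close>. Since \<open>U\<close> is open, values of \<open>f\<close> off \<open>U\<close>
  are irrelevant.
\<close>

primrec C_diff :: "nat \<Rightarrow> nat \<Rightarrow> (nat \<Rightarrow> real) set \<Rightarrow> ((nat \<Rightarrow> real) \<Rightarrow> real) \<Rightarrow> bool" where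
  "C_diff 0 n U f \<longleftrightarrow>
     continuous_map (subtopology (Euclidean_space n) U) euclideanreal f"
| "C_diff (Suc k) n U f \<longleftrightarrow>
     continuous_map (subtopology (Euclidean_space n) U) euclideanreal f \<and>
     (\<exists>g. \<forall>i<n. (\<forall>x\<in>U. ((\<lambda>t. f (x(i := t))) has_real_derivative g i x) (at (x i))) \<and>
               C_diff k n U (g i))"

definition smooth_fun :: "nat \<Rightarrow> (nat \<Rightarrow> real) set \<Rightarrow> ((nat \<Rightarrow> real) \<Rightarrow> real) \<Rightarrow> bool" where
  "smooth_fun n U f \<longleftrightarrow> (\<forall>k. C_diff k n U f)"

definition smooth_between ::
    "nat \<Rightarrow> (nat \<Rightarrow> real) set \<Rightarrow> nat \<Rightarrow> (nat \<Rightarrow> real) set \<Rightarrow> ((nat \<Rightarrow> real) \<Rightarrow> (nat \<Rightarrow> real)) \<Rightarrow> bool"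
  where
  "smooth_between m V n U f \<longleftrightarrow> f \<in> V \<rightarrow> U \<and> (\<forall>i<n. smooth_fun m V (\<lambda>x. f x i))"

section \<open>Diffeological spaces\<close>

text \<open>
  \<open>P n U\<close> is the set of plots with domain the open subset \<open>U\<close> of \<open>n\<close>-dimensional space.
  A function with domain \<open>U\<close> is represented by a total function that is \<^const>\<open>undefined\<close> off \<open>U\<close>
  (\<^const>\<open>PiE\<close>, \<^const>\<open>extensional\<close>), so that plots are determined by their values on \<open>U\<close>.
\<close>

type_synonym 'x plots = "nat \<Rightarrow> (nat \<Rightarrow> real) set \<Rightarrow> ((nat \<Rightarrow> real) \<Rightarrow> 'x) set"

locale diffeological_space =
  fixes A :: "'x set" and P :: "'x plots"
  assumes plotD: "p \<in> P n U \<Longrightarrow> openin (Euclidean_space n) U \<and> p \<in> U \<rightarrow>\<^sub>E A"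
    and plot_const:
      "\<lbrakk>openin (Euclidean_space n) U; x \<in> A\<rbrakk> \<Longrightarrow> (\<lambda>u\<in>U. x) \<in> P n U"
    and plot_compose:
      "\<lbrakk>p \<in> P n U; openin (Euclidean_space m) V; smooth_between m V n U f\<rbrakk>
        \<Longrightarrow> compose V p f \<in> P m V"
    and plot_glue:
      "\<lbrakk>\<And>W. W \<in> \<U> \<Longrightarrow> openin (Euclidean_space n) W; U = \<Union>\<U>; p \<in> U \<rightarrow>\<^sub>E A;
        \<And>W. W \<in> \<U> \<Longrightarrow> restrict p W \<in> P n W\<rbrakk> \<Longrightarrow> p \<in> P n U"

definition smooth_map :: "'x set \<Rightarrow> 'x plots \<Rightarrow> 'y set \<Rightarrow> 'y plots \<Rightarrow> ('x \<Rightarrow> 'y) \<Rightarrow> bool" where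
  "smooth_map A P B Q f \<longleftrightarrow> f \<in> A \<rightarrow> B \<and> (\<forall>n U. \<forall>p\<in>P n U. compose U f p \<in> Q n U)"

definition prod_plots :: "'x plots \<Rightarrow> 'y plots \<Rightarrow> ('x \<times> 'y) plots" where
  "prod_plots P Q n U =
     {r \<in> extensional U. compose U fst r \<in> P n U \<and> compose U snd r \<in> Q n U}"

definition real_plots :: "real plots" where
  "real_plots n U =
     {c \<in> extensional U. openin (Euclidean_space n) U \<and> smooth_fun n U c}"

section \<open>Diffeological vector spaces\<close>

text \<open>
  A real vector space is a HOL-Algebra module over the field of real numbers. (The module record
  inherits fields \<open>mult\<close> and \<open>one\<close> from the ring record; as always for modules they carry no
  meaning.)
\<close>

abbreviation real_field :: "real ring" where
  "real_field \<equiv> ring_of_type_algebra"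

record 'v dvs = "(real, 'v) module" +
  plots :: "'v plots"

locale diffeological_vector_space =
  module real_field V + diffeological_space "carrier V" "plots V"
  for V :: "'v dvs" (structure) +
  assumes smooth_add:
      "smooth_map (carrier V \<times> carrier V) (prod_plots (plots V) (plots V))
                  (carrier V) (plots V) (\<lambda>(x, y). x \<oplus>\<^bsub>V\<^esub> y)"
    and smooth_smult:
      "smooth_map (UNIV \<times> carrier V) (prod_plots real_plots (plots V))
                  (carrier V) (plots V) (\<lambda>(a, x). a \<odot>\<^bsub>V\<^esub> x)"

text \<open>
  The morphisms of DVect. The two spaces may live over different types: this lets cones have
  vertices of arbitrary size.
\<close>

definition smooth_linear_maps :: "'v dvs \<Rightarrow> 'w dvs \<Rightarrow> ('v \<Rightarrow> 'w) set" where
  "smooth_linear_maps V W =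
     {h \<in> carrier V \<rightarrow>\<^sub>E carrier W.
        (\<forall>x\<in>carrier V. \<forall>y\<in>carrier V. h (x \<oplus>\<^bsub>V\<^esub> y) = h x \<oplus>\<^bsub>W\<^esub> h y) \<and>
        (\<forall>a. \<forall>x\<in>carrier V. h (a \<odot>\<^bsub>V\<^esub> x) = a \<odot>\<^bsub>W\<^esub> h x) \<and>
        smooth_map (carrier V) (plots V) (carrier W) (plots W) h}"

section \<open>Categories and functors\<close>

text \<open>
  Hom-sets need not be disjoint, so identities, composition and the action of a functor on
  morphisms carry the objects as arguments; \<open>Comp C x y z g f\<close> is \<open>g\<close> after \<open>f\<close> for
  \<open>f \<in> Hom C x y\<close> and \<open>g \<in> Hom C y z\<close>. A category in this sense is small:
  its objects and its hom-sets form sets.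
\<close>

record ('o, 'm) category_data =
  Obj :: "'o set"
  Hom :: "'o \<Rightarrow> 'o \<Rightarrow> 'm set"
  Ident :: "'o \<Rightarrow> 'm"
  Comp :: "'o \<Rightarrow> 'o \<Rightarrow> 'o \<Rightarrow> 'm \<Rightarrow> 'm \<Rightarrow> 'm"

locale category =
  fixes C :: "('o, 'm) category_data"
  assumes Ident_in: "x \<in> Obj C \<Longrightarrow> Ident C x \<in> Hom C x x"
    and Comp_in:
      "\<lbrakk>x \<in> Obj C; y \<in> Obj C; z \<in> Obj C; f \<in> Hom C x y; g \<in> Hom C y z\<rbrakk>
        \<Longrightarrow> Comp C x y z g f \<in> Hom C x z"
    and Comp_Ident_right:
      "\<lbrakk>x \<in> Obj C; y \<in> Obj C; f \<in> Hom C x y\<rbrakk> \<Longrightarrow> Comp C x x y f (Ident C x) = f"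
    and Comp_Ident_left:
      "\<lbrakk>x \<in> Obj C; y \<in> Obj C; f \<in> Hom C x y\<rbrakk> \<Longrightarrow> Comp C x y y (Ident C y) f = f"
    and Comp_assoc:
      "\<lbrakk>w \<in> Obj C; x \<in> Obj C; y \<in> Obj C; z \<in> Obj C;
        f \<in> Hom C w x; g \<in> Hom C x y; h \<in> Hom C y z\<rbrakk>
        \<Longrightarrow> Comp C w y z h (Comp C w x y g f) = Comp C w x z (Comp C x y z h g) f"

locale cat_functor = J: category J + C: category C
  for J :: "('o, 'm) category_data" and C :: "('p, 'n) category_data" +
  fixes FO :: "'o \<Rightarrow> 'p" and FM :: "'o \<Rightarrow> 'o \<Rightarrow> 'm \<Rightarrow> 'n"
  assumes FO_in: "x \<in> Obj J \<Longrightarrow> FO x \<in> Obj C"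
    and FM_in:
      "\<lbrakk>x \<in> Obj J; y \<in> Obj J; f \<in> Hom J x y\<rbrakk> \<Longrightarrow> FM x y f \<in> Hom C (FO x) (FO y)"
    and FM_Ident: "x \<in> Obj J \<Longrightarrow> FM x x (Ident J x) = Ident C (FO x)"
    and FM_Comp:
      "\<lbrakk>x \<in> Obj J; y \<in> Obj J; z \<in> Obj J; f \<in> Hom J x y; g \<in> Hom J y z\<rbrakk>
        \<Longrightarrow> FM x z (Comp J x y z g f) = Comp C (FO x) (FO y) (FO z) (FM y z g) (FM x y f)"

section \<open>The category DVect and limits in it\<close>

text \<open>
  \<open>DVect\<close> is polymorphic: its instance at \<open>'v\<close> has as objects the diffeological vector spaces
  whose points are elements of \<open>'v\<close>. The union of all instances plays the role of the (large)
  category of all diffeological vector spaces.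
\<close>

definition DVect :: "('v dvs, 'v \<Rightarrow> 'v) category_data" where
  "DVect = \<lparr>Obj = {V. diffeological_vector_space V},
            Hom = smooth_linear_maps,
            Ident = (\<lambda>V. \<lambda>x\<in>carrier V. x),
            Comp = (\<lambda>U V W g f. compose (carrier U) g f)\<rparr>"

lemma category_DVect: "category DVect"
proof
  fix V :: "'v dvs" assume "V \<in> Obj DVect"
  then interpret diffeological_vector_space V by (simp add: DVect_def)
  have "compose U (\<lambda>x\<in>carrier V. x) p = p" if "p \<in> plots V n U" for n U p
    using plotD[OF that] by (auto simp: compose_def fun_eq_iff PiE_def extensional_def)
  moreover have "a \<odot>\<^bsub>V\<^esub> x \<in> carrier V" if "x \<in> carrier V" for a x
    using that smult_closed[of a x] by (simp add: ring_of_type_algebra_def)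
  ultimately show "Ident DVect V \<in> Hom DVect V V"
    by (auto simp: DVect_def smooth_linear_maps_def smooth_map_def)
next
  fix U V W :: "'v dvs" and f g
  assume *: "U \<in> Obj DVect" "V \<in> Obj DVect" "W \<in> Obj DVect"
    "f \<in> Hom DVect U V" "g \<in> Hom DVect V W"
  interpret U: diffeological_vector_space U using * by (simp add: DVect_def)
  have f: "f \<in> smooth_linear_maps U V" and g: "g \<in> smooth_linear_maps V W"
    using * by (auto simp: DVect_def)
  have eq: "compose S (compose (carrier U) g f) p = compose S g (compose S f p)"
    if "p \<in> plots U n S" for n S p
    using U.plotD[OF that] by (auto simp: compose_def fun_eq_iff)
  have "smooth_map (carrier U) (plots U) (carrier W) (plots W) (compose (carrier U) g f)"
    using f g eq by (auto simp: smooth_linear_maps_def smooth_map_def compose_eq)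
  moreover have "a \<odot>\<^bsub>U\<^esub> x \<in> carrier U" if "x \<in> carrier U" for a x
    using that U.smult_closed[of a x] by (simp add: ring_of_type_algebra_def)
  ultimately show "Comp DVect U V W g f \<in> Hom DVect U W"
    using f g by (auto simp: DVect_def smooth_linear_maps_def compose_def PiE_iff Pi_iff)
qed (auto simp: DVect_def smooth_linear_maps_def PiE_iff compose_def extensional_def fun_eq_iff)

definition DVect_cone ::
    "('o, 'm) category_data \<Rightarrow> ('o \<Rightarrow> 'v dvs) \<Rightarrow> ('o \<Rightarrow> 'o \<Rightarrow> 'm \<Rightarrow> 'v \<Rightarrow> 'v) \<Rightarrow>
     'w dvs \<Rightarrow> ('o \<Rightarrow> 'w \<Rightarrow> 'v) \<Rightarrow> bool" where
  "DVect_cone J FO FM W q \<longleftrightarrow>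
     diffeological_vector_space W \<and>
     (\<forall>x\<in>Obj J. q x \<in> smooth_linear_maps W (FO x)) \<and>
     (\<forall>x\<in>Obj J. \<forall>y\<in>Obj J. \<forall>f\<in>Hom J x y. compose (carrier W) (FM x y f) (q x) = q y)"

text \<open>
  \<open>(L, p)\<close> is a limit cone, tested against all cones whose vertex has its points in the
  type \<open>'w\<close>. HOL cannot quantify over types inside a formula, so that one and the same \<open>(L, p)\<close> is
  universal among cones of every size is expressed by two assertions: a limit cone exists among the
  spaces over one fixed type, and every such limit cone passes the test for an arbitrary type \<open>'w\<close>.
\<close>

definition DVect_limit ::
    "'w itself \<Rightarrow> ('o, 'm) category_data \<Rightarrow> ('o \<Rightarrow> 'v dvs) \<Rightarrow> ('o \<Rightarrow> 'o \<Rightarrow> 'm \<Rightarrow> 'v \<Rightarrow> 'v) \<Rightarrow>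
     'l dvs \<Rightarrow> ('o \<Rightarrow> 'l \<Rightarrow> 'v) \<Rightarrow> bool" where
  "DVect_limit T J FO FM L p \<longleftrightarrow>
     DVect_cone J FO FM L p \<and>
     (\<forall>(W :: 'w dvs) q. DVect_cone J FO FM W q \<longrightarrow>
        (\<exists>!h. h \<in> smooth_linear_maps W L \<and>
              (\<forall>x\<in>Obj J. compose (carrier W) (p x) h = q x)))"

end

theory Submission
  imports Defs
begin

text \<open>
  The limit is the space of compatible families with pointwise operations; a map into it is a plot
  iff all its components are plots. The mediating map of a cone tuples the components of the cone,
  whatever the type of its vertex. Any other limit cone over the same type is isomorphic to this one
  (the isomorphism only needs cones over that type), so it inherits the universal property
  for vertices of every type.
\<close>

section \<open>Diffeological vector spaces and smooth linear maps\<close>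

lemma real_field_simps [simp]:
  "carrier real_field = UNIV" "a \<oplus>\<^bsub>real_field\<^esub> b = a + b" "a \<otimes>\<^bsub>real_field\<^esub> b = a * b"
  "\<zero>\<^bsub>real_field\<^esub> = 0" "\<one>\<^bsub>real_field\<^esub> = 1"
  by (simp_all add: ring_of_type_algebra_def)

text \<open>The module laws mention the carrier and constants of \<open>real_field\<close>. Stated
  with plain reals instead, they serve as rewrite rules.\<close>

lemma (in diffeological_vector_space) real_smult [simp]:
  assumes "v \<in> carrier V"
  shows "a \<odot> v \<in> carrier V" "0 \<odot> v = \<zero>" "1 \<odot> v = v"
  using smult_closed[of a v] smult_l_null[of v] smult_one[of v] assms by simp_all

text \<open>Distributivity at the scalars -1 and 1 supplies additive inverses as scalar multiples,
  which spares a separate negation on families.\<close>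

lemma (in diffeological_vector_space) minus_one_smult:
  assumes "v \<in> carrier V"
  shows "(-1) \<odot> v \<oplus> v = \<zero>"
  using smult_l_distr[of "-1" 1 v, symmetric] assms by simp

text \<open>The pairing of \<open>p\<close> and \<open>q\<close> is a plot of the product because
  its two components are, and smoothness of addition sends it to the pointwise sum.
  \<open>plot_smult\<close> follows the same pattern.\<close>

lemma (in diffeological_vector_space) plot_add:
  assumes "p \<in> plots V n U" "q \<in> plots V n U"
  shows "(\<lambda>u\<in>U. p u \<oplus> q u) \<in> plots V n U"
proof -
  let ?r = "\<lambda>u\<in>U. (p u, q u)"
  have "compose U fst ?r = p" "compose U snd ?r = q"
    using plotD[OF assms(1)] plotD[OF assms(2)]
    by (auto simp: compose_def fun_eq_iff PiE_def extensional_def)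
  then have "?r \<in> prod_plots (plots V) (plots V) n U"
    using assms by (simp add: prod_plots_def)
  then have "compose U (\<lambda>(x, y). x \<oplus> y) ?r \<in> plots V n U"
    using smooth_add by (simp add: smooth_map_def)
  also have "compose U (\<lambda>(x, y). x \<oplus> y) ?r = (\<lambda>u\<in>U. p u \<oplus> q u)"
    by (auto simp: compose_def)
  finally show ?thesis .
qed

lemma (in diffeological_vector_space) plot_smult:
  assumes "c \<in> real_plots n U" "p \<in> plots V n U"
  shows "(\<lambda>u\<in>U. c u \<odot> p u) \<in> plots V n U"
proof -
  let ?r = "\<lambda>u\<in>U. (c u, p u)"
  have "compose U fst ?r = c" "compose U snd ?r = p"
    using plotD[OF assms(2)] assms(1)
    by (auto simp: compose_def fun_eq_iff PiE_def extensional_def real_plots_def)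
  then have "?r \<in> prod_plots real_plots (plots V) n U"
    using assms by (simp add: prod_plots_def)
  then have "compose U (\<lambda>(a, x). a \<odot> x) ?r \<in> plots V n U"
    using smooth_smult by (simp add: smooth_map_def)
  also have "compose U (\<lambda>(a, x). a \<odot> x) ?r = (\<lambda>u\<in>U. c u \<odot> p u)"
    by (auto simp: compose_def)
  finally show ?thesis .
qed

text \<open>Morphisms are only required to be additive and homogeneous; homogeneity at the scalar 0
  yields preservation of zero.\<close>

lemma smooth_linear_maps_zero:
  assumes "diffeological_vector_space V" "diffeological_vector_space W"
    and h: "h \<in> smooth_linear_maps V W"
  shows "h \<zero>\<^bsub>V\<^esub> = \<zero>\<^bsub>W\<^esub>"
proof -
  interpret V: diffeological_vector_space V by fact
  interpret W: diffeological_vector_space W by fact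
  \<comment> \<open>The deleted simp rules would collapse the scalar multiples before homogeneity of
    \<open>h\<close> could be applied.\<close>
  have "h (0 \<odot>\<^bsub>V\<^esub> \<zero>\<^bsub>V\<^esub>) = 0 \<odot>\<^bsub>W\<^esub> h \<zero>\<^bsub>V\<^esub>" "h \<zero>\<^bsub>V\<^esub> \<in> carrier W"
    using h V.zero_closed
    by (force simp: smooth_linear_maps_def
        simp del: V.real_smult W.real_smult V.smult_r_null)+
  then show ?thesis by simp
qed

text \<open>\<open>category_DVect\<close> speaks of spaces over one common type. Composites with a
  cone vertex need three independent point types.\<close>

lemma smooth_linear_maps_compose:
  assumes "diffeological_vector_space U"
    and f: "f \<in> smooth_linear_maps U V" and g: "g \<in> smooth_linear_maps V W"
  shows "compose (carrier U) g f \<in> smooth_linear_maps U W"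
proof -
  interpret U: diffeological_vector_space U by fact
  have eq: "compose S (compose (carrier U) g f) p = compose S g (compose S f p)"
    if "p \<in> plots U n S" for n S p
    using U.plotD[OF that] by (auto simp: compose_def fun_eq_iff)
  have "smooth_map (carrier U) (plots U) (carrier W) (plots W) (compose (carrier U) g f)"
    using f g eq by (auto simp: smooth_linear_maps_def smooth_map_def compose_eq)
  moreover have "a \<odot>\<^bsub>U\<^esub> x \<in> carrier U" if "x \<in> carrier U" for a x
    using that by simp
  ultimately show ?thesis
    using f g by (auto simp: smooth_linear_maps_def compose_def PiE_iff Pi_iff)
qed

lemma smooth_linear_maps_id:
  assumes "diffeological_vector_space V"
  shows "(\<lambda>x\<in>carrier V. x) \<in> smooth_linear_maps V V"
  using category.Ident_in[OF category_DVect, of V] assms by (simp add: DVect_def)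

section \<open>The space of compatible families\<close>

text \<open>This is the usual subspace of the product, with the coarsest diffeology that makes all
  projections smooth. Openness of \<open>U\<close> is demanded explicitly, since over an empty
  \<open>Obj J\<close> no component could guarantee it. The ring fields \<open>mult\<close> and
  \<open>one\<close> are meaningless for a module and stay \<open>undefined\<close>.\<close>

definition limit_space ::
    "('o, 'm) category_data \<Rightarrow> ('o \<Rightarrow> 'v dvs) \<Rightarrow> ('o \<Rightarrow> 'o \<Rightarrow> 'm \<Rightarrow> 'v \<Rightarrow> 'v) \<Rightarrow> ('o \<Rightarrow> 'v) dvs" where
  "limit_space J FO FM =
     (let A = {s \<in> \<Pi>\<^sub>E x\<in>Obj J. carrier (FO x).
                 \<forall>x\<in>Obj J. \<forall>y\<in>Obj J. \<forall>f\<in>Hom J x y. FM x y f (s x) = s y}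
      in \<lparr>carrier = A, monoid.mult = undefined, one = undefined,
          ring.zero = (\<lambda>x\<in>Obj J. \<zero>\<^bsub>FO x\<^esub>),
          add = (\<lambda>s t. \<lambda>x\<in>Obj J. s x \<oplus>\<^bsub>FO x\<^esub> t x),
          module.smult = (\<lambda>a s. \<lambda>x\<in>Obj J. a \<odot>\<^bsub>FO x\<^esub> s x),
          plots = (\<lambda>n U. {p \<in> U \<rightarrow>\<^sub>E A. openin (Euclidean_space n) U \<and>
                            (\<forall>x\<in>Obj J. (\<lambda>u\<in>U. p u x) \<in> plots (FO x) n U)})\<rparr>)"

definition limit_proj ::
    "('o, 'm) category_data \<Rightarrow> ('o \<Rightarrow> 'v dvs) \<Rightarrow> ('o \<Rightarrow> 'o \<Rightarrow> 'm \<Rightarrow> 'v \<Rightarrow> 'v) \<Rightarrow> 'o \<Rightarrow> ('o \<Rightarrow> 'v) \<Rightarrow> 'v" where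
  "limit_proj J FO FM x = (\<lambda>s\<in>carrier (limit_space J FO FM). s x)"

locale DVect_diagram = cat_functor J DVect FO FM
  for J :: "('o, 'm) category_data"
    and FO :: "'o \<Rightarrow> 'v dvs"
    and FM :: "'o \<Rightarrow> 'o \<Rightarrow> 'm \<Rightarrow> 'v \<Rightarrow> 'v"
begin

abbreviation L where "L \<equiv> limit_space J FO FM"
abbreviation \<pi> where "\<pi> \<equiv> limit_proj J FO FM"

lemma dvs_FO: "x \<in> Obj J \<Longrightarrow> diffeological_vector_space (FO x)"
  using FO_in by (simp add: DVect_def)

lemma FM_smooth_linear:
  "\<lbrakk>x \<in> Obj J; y \<in> Obj J; f \<in> Hom J x y\<rbrakk> \<Longrightarrow> FM x y f \<in> smooth_linear_maps (FO x) (FO y)"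
  using FM_in by (simp add: DVect_def)

lemma carrier_L:
  "s \<in> carrier L \<longleftrightarrow> s \<in> (\<Pi>\<^sub>E x\<in>Obj J. carrier (FO x)) \<and>
     (\<forall>x\<in>Obj J. \<forall>y\<in>Obj J. \<forall>f\<in>Hom J x y. FM x y f (s x) = s y)"
  by (simp add: limit_space_def Let_def)

lemma plots_L:
  "p \<in> plots L n U \<longleftrightarrow> p \<in> U \<rightarrow>\<^sub>E carrier L \<and> openin (Euclidean_space n) U \<and>
     (\<forall>x\<in>Obj J. (\<lambda>u\<in>U. p u x) \<in> plots (FO x) n U)"
  by (simp add: limit_space_def Let_def)

lemma ops_L:
  "\<zero>\<^bsub>L\<^esub> = (\<lambda>x\<in>Obj J. \<zero>\<^bsub>FO x\<^esub>)"
  "s \<oplus>\<^bsub>L\<^esub> t = (\<lambda>x\<in>Obj J. s x \<oplus>\<^bsub>FO x\<^esub> t x)"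
  "a \<odot>\<^bsub>L\<^esub> s = (\<lambda>x\<in>Obj J. a \<odot>\<^bsub>FO x\<^esub> s x)"
  by (simp_all add: limit_space_def Let_def)

lemma component_closed: "\<lbrakk>s \<in> carrier L; x \<in> Obj J\<rbrakk> \<Longrightarrow> s x \<in> carrier (FO x)"
  by (auto simp: carrier_L)

section \<open>Linear structure on compatible families\<close>

lemma zero_closed_L: "\<zero>\<^bsub>L\<^esub> \<in> carrier L"
proof -
  have "\<zero>\<^bsub>FO x\<^esub> \<in> carrier (FO x)" if "x \<in> Obj J" for x
  proof -
    interpret diffeological_vector_space "FO x" using dvs_FO that .
    show ?thesis by simp
  qed
  then show ?thesis
    by (auto simp: carrier_L ops_L smooth_linear_maps_zero[OF dvs_FO dvs_FO FM_smooth_linear])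
qed

text \<open>The maps of the diagram are additive, so they carry the sum of two compatible families
  to the sum at the target object.\<close>

lemma add_closed_L:
  assumes "s \<in> carrier L" "t \<in> carrier L"
  shows "s \<oplus>\<^bsub>L\<^esub> t \<in> carrier L"
proof -
  have "s x \<oplus>\<^bsub>FO x\<^esub> t x \<in> carrier (FO x)" if "x \<in> Obj J" for x
  proof -
    interpret diffeological_vector_space "FO x" using dvs_FO that .
    show ?thesis using assms that by (simp add: component_closed)
  qed
  moreover have "FM x y f (s x \<oplus>\<^bsub>FO x\<^esub> t x) = s y \<oplus>\<^bsub>FO y\<^esub> t y"
    if "x \<in> Obj J" "y \<in> Obj J" "f \<in> Hom J x y" for x y f
    using FM_smooth_linear[OF that] assms that
    by (auto simp: smooth_linear_maps_def component_closed carrier_L PiE_iff)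
  ultimately show ?thesis by (auto simp: carrier_L ops_L)
qed

lemma smult_closed_L:
  assumes "s \<in> carrier L"
  shows "a \<odot>\<^bsub>L\<^esub> s \<in> carrier L"
proof -
  have "a \<odot>\<^bsub>FO x\<^esub> s x \<in> carrier (FO x)" if "x \<in> Obj J" for x
  proof -
    interpret diffeological_vector_space "FO x" using dvs_FO that .
    show ?thesis using assms that by (simp add: component_closed)
  qed
  moreover have "FM x y f (a \<odot>\<^bsub>FO x\<^esub> s x) = a \<odot>\<^bsub>FO y\<^esub> s y"
    if "x \<in> Obj J" "y \<in> Obj J" "f \<in> Hom J x y" for x y f
    using FM_smooth_linear[OF that] assms that
    by (auto simp: smooth_linear_maps_def component_closed carrier_L PiE_iff)
  ultimately show ?thesis by (auto simp: carrier_L ops_L)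
qed

text \<open>Every axiom is checked at one object \<open>x\<close> at a time, where it is an axiom of
  \<open>FO x\<close>.\<close>

lemma module_L: "module real_field L"
proof (rule moduleI)
  show "abelian_group L"
  proof (rule abelian_groupI)
    fix s t r assume *: "s \<in> carrier L" "t \<in> carrier L" "r \<in> carrier L"
    have "s x \<oplus>\<^bsub>FO x\<^esub> t x \<oplus>\<^bsub>FO x\<^esub> r x = s x \<oplus>\<^bsub>FO x\<^esub> (t x \<oplus>\<^bsub>FO x\<^esub> r x)" if "x \<in> Obj J" for x
    proof -
      interpret diffeological_vector_space "FO x" using dvs_FO that .
      show ?thesis using * that by (simp add: component_closed a_assoc)
    qed
    then show "s \<oplus>\<^bsub>L\<^esub> t \<oplus>\<^bsub>L\<^esub> r = s \<oplus>\<^bsub>L\<^esub> (t \<oplus>\<^bsub>L\<^esub> r)"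
      by (auto simp: ops_L)
  next
    fix s t assume *: "s \<in> carrier L" "t \<in> carrier L"
    have "s x \<oplus>\<^bsub>FO x\<^esub> t x = t x \<oplus>\<^bsub>FO x\<^esub> s x" if "x \<in> Obj J" for x
    proof -
      interpret diffeological_vector_space "FO x" using dvs_FO that .
      show ?thesis using * that by (simp add: component_closed a_comm)
    qed
    then show "s \<oplus>\<^bsub>L\<^esub> t = t \<oplus>\<^bsub>L\<^esub> s"
      by (auto simp: ops_L)
  next
    fix s assume *: "s \<in> carrier L"
    have "\<zero>\<^bsub>FO x\<^esub> \<oplus>\<^bsub>FO x\<^esub> s x = s x" "(-1) \<odot>\<^bsub>FO x\<^esub> s x \<oplus>\<^bsub>FO x\<^esub> s x = \<zero>\<^bsub>FO x\<^esub>"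
      if "x \<in> Obj J" for x
    proof -
      interpret diffeological_vector_space "FO x" using dvs_FO that .
      show "\<zero>\<^bsub>FO x\<^esub> \<oplus>\<^bsub>FO x\<^esub> s x = s x" "(-1) \<odot>\<^bsub>FO x\<^esub> s x \<oplus>\<^bsub>FO x\<^esub> s x = \<zero>\<^bsub>FO x\<^esub>"
        using * that by (simp_all add: component_closed minus_one_smult)
    qed
    \<comment> \<open>The first equation returns \<open>s\<close> itself, so agreement on
      \<open>Obj J\<close> has to be completed by the fact that \<open>s\<close> is undefined
      elsewhere. The second exhibits the multiple by -1 as the inverse of \<open>s\<close>.\<close>
    then have "\<zero>\<^bsub>L\<^esub> \<oplus>\<^bsub>L\<^esub> s = s" "(-1) \<odot>\<^bsub>L\<^esub> s \<oplus>\<^bsub>L\<^esub> s = \<zero>\<^bsub>L\<^esub>"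
      using * by (auto simp: ops_L carrier_L PiE_def extensional_def fun_eq_iff)
    then show "\<zero>\<^bsub>L\<^esub> \<oplus>\<^bsub>L\<^esub> s = s" "\<exists>t\<in>carrier L. t \<oplus>\<^bsub>L\<^esub> s = \<zero>\<^bsub>L\<^esub>"
      using smult_closed_L[OF *] by auto
  qed (simp_all add: zero_closed_L add_closed_L)
next
  fix a b s assume *: "s \<in> carrier L"
  have "(a + b) \<odot>\<^bsub>FO x\<^esub> s x = a \<odot>\<^bsub>FO x\<^esub> s x \<oplus>\<^bsub>FO x\<^esub> b \<odot>\<^bsub>FO x\<^esub> s x"
    "(a * b) \<odot>\<^bsub>FO x\<^esub> s x = a \<odot>\<^bsub>FO x\<^esub> (b \<odot>\<^bsub>FO x\<^esub> s x)" if "x \<in> Obj J" for x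
  proof -
    interpret diffeological_vector_space "FO x" using dvs_FO that .
    show "(a + b) \<odot>\<^bsub>FO x\<^esub> s x = a \<odot>\<^bsub>FO x\<^esub> s x \<oplus>\<^bsub>FO x\<^esub> b \<odot>\<^bsub>FO x\<^esub> s x"
      "(a * b) \<odot>\<^bsub>FO x\<^esub> s x = a \<odot>\<^bsub>FO x\<^esub> (b \<odot>\<^bsub>FO x\<^esub> s x)"
      using smult_l_distr[of a b "s x"] smult_assoc1[of a b "s x"] component_closed[OF * that]
      by simp_all
  qed
  then show "(a \<oplus>\<^bsub>real_field\<^esub> b) \<odot>\<^bsub>L\<^esub> s = a \<odot>\<^bsub>L\<^esub> s \<oplus>\<^bsub>L\<^esub> b \<odot>\<^bsub>L\<^esub> s"
    "(a \<otimes>\<^bsub>real_field\<^esub> b) \<odot>\<^bsub>L\<^esub> s = a \<odot>\<^bsub>L\<^esub> (b \<odot>\<^bsub>L\<^esub> s)"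
    by (auto simp: ops_L)
next
  fix a s t assume *: "s \<in> carrier L" "t \<in> carrier L"
  have "a \<odot>\<^bsub>FO x\<^esub> (s x \<oplus>\<^bsub>FO x\<^esub> t x) = a \<odot>\<^bsub>FO x\<^esub> s x \<oplus>\<^bsub>FO x\<^esub> a \<odot>\<^bsub>FO x\<^esub> t x" if "x \<in> Obj J" for x
  proof -
    interpret diffeological_vector_space "FO x" using dvs_FO that .
    show ?thesis using * that by (simp add: component_closed smult_r_distr)
  qed
  then show "a \<odot>\<^bsub>L\<^esub> (s \<oplus>\<^bsub>L\<^esub> t) = a \<odot>\<^bsub>L\<^esub> s \<oplus>\<^bsub>L\<^esub> a \<odot>\<^bsub>L\<^esub> t"
    by (auto simp: ops_L)
next
  fix s assume *: "s \<in> carrier L"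
  have "1 \<odot>\<^bsub>FO x\<^esub> s x = s x" if "x \<in> Obj J" for x
  proof -
    interpret diffeological_vector_space "FO x" using dvs_FO that .
    show ?thesis using component_closed[OF * that] by simp
  qed
  then show "\<one>\<^bsub>real_field\<^esub> \<odot>\<^bsub>L\<^esub> s = s"
    using * by (auto simp: ops_L carrier_L PiE_def extensional_def fun_eq_iff)
qed (simp_all add: smult_closed_L cring_from_type_algebra)

section \<open>Diffeology on compatible families and smoothness of the operations\<close>

lemma diffeological_space_L: "diffeological_space (carrier L) (plots L)"
proof
  fix n U and s :: "'o \<Rightarrow> 'v"
  assume *: "openin (Euclidean_space n) U" "s \<in> carrier L"
  have "(\<lambda>u\<in>U. s x) \<in> plots (FO x) n U" if "x \<in> Obj J" for x
  proof -
    interpret diffeological_vector_space "FO x" using dvs_FO that .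
    show ?thesis using * that by (simp add: component_closed plot_const)
  qed
  moreover have "(\<lambda>u\<in>U. (\<lambda>u\<in>U. s) u x) = (\<lambda>u\<in>U. s x)" for x by auto
  ultimately show "(\<lambda>u\<in>U. s) \<in> plots L n U"
    using * by (simp add: plots_L)
next
  fix n U m V p f
  assume *: "p \<in> plots L n U" "openin (Euclidean_space m) V" "smooth_between m V n U f"
  have f: "f \<in> V \<rightarrow> U" using *(3) by (simp add: smooth_between_def)
  have "(\<lambda>v\<in>V. compose V p f v x) \<in> plots (FO x) m V" if "x \<in> Obj J" for x
  proof -
    interpret diffeological_vector_space "FO x" using dvs_FO that .
    have "compose V (\<lambda>u\<in>U. p u x) f \<in> plots (FO x) m V"
      using * that by (intro plot_compose) (auto simp: plots_L)
    \<comment> \<open>Taking components commutes with reparametrization: \<open>f\<close> maps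
      \<open>V\<close> into \<open>U\<close>, so the truncation of the component off
      \<open>U\<close> is never seen.\<close>
    also have "compose V (\<lambda>u\<in>U. p u x) f = (\<lambda>v\<in>V. compose V p f v x)"
      using f by (auto simp: compose_def fun_eq_iff)
    finally show ?thesis .
  qed
  then show "compose V p f \<in> plots L m V"
    using * f by (auto simp: plots_L compose_def)
next
  fix n U p and \<U> :: "(nat \<Rightarrow> real) set set"
  assume open_W: "\<And>W. W \<in> \<U> \<Longrightarrow> openin (Euclidean_space n) W" and U: "U = \<Union>\<U>"
    and p: "p \<in> U \<rightarrow>\<^sub>E carrier L" and plot_W: "\<And>W. W \<in> \<U> \<Longrightarrow> restrict p W \<in> plots L n W"
  have "(\<lambda>u\<in>U. p u x) \<in> plots (FO x) n U" if x: "x \<in> Obj J" for x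
  proof -
    interpret diffeological_vector_space "FO x" using dvs_FO x .
    show ?thesis
    proof (rule plot_glue[OF open_W U])
      show "(\<lambda>u\<in>U. p u x) \<in> U \<rightarrow>\<^sub>E carrier (FO x)"
        using p x by (auto intro!: component_closed)
      fix W assume W: "W \<in> \<U>"
      \<comment> \<open>Taking components also commutes with restriction to a member of the cover,
        so gluing reduces to gluing in \<open>FO x\<close>.\<close>
      have "restrict (\<lambda>u\<in>U. p u x) W = (\<lambda>u\<in>W. restrict p W u x)"
        using W U by (auto simp: fun_eq_iff)
      then show "restrict (\<lambda>u\<in>U. p u x) W \<in> plots (FO x) n W"
        using plot_W[OF W] x by (simp add: plots_L)
    qed
  qed
  moreover have "openin (Euclidean_space n) U" using open_W U by auto
  ultimately show "p \<in> plots L n U" using p by (simp add: plots_L)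
qed (simp add: plots_L)

lemma component_plot:
  "\<lbrakk>p \<in> plots L n U; x \<in> Obj J\<rbrakk> \<Longrightarrow> (\<lambda>u\<in>U. p u x) \<in> plots (FO x) n U"
  by (simp add: plots_L)

text \<open>A plot of the product splits into its two component plots. The operations of
  \<open>L\<close> are pointwise, so the component at \<open>x\<close> of the result is the same
  operation applied in \<open>FO x\<close>, where \<open>plot_add\<close> and
  \<open>plot_smult\<close> apply.\<close>

lemma dvs_L: "diffeological_vector_space L"
proof (intro diffeological_vector_space.intro diffeological_vector_space_axioms.intro)
  show "smooth_map (carrier L \<times> carrier L) (prod_plots (plots L) (plots L))
          (carrier L) (plots L) (\<lambda>(s, t). s \<oplus>\<^bsub>L\<^esub> t)"
    unfolding smooth_map_def
  proof (intro conjI allI ballI)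
    fix n U r assume r: "r \<in> prod_plots (plots L) (plots L) n U"
    let ?p = "compose U fst r" and ?q = "compose U snd r"
    have pq: "?p \<in> plots L n U" "?q \<in> plots L n U"
      using r by (auto simp: prod_plots_def)
    have eq: "compose U (\<lambda>(s, t). s \<oplus>\<^bsub>L\<^esub> t) r = (\<lambda>u\<in>U. ?p u \<oplus>\<^bsub>L\<^esub> ?q u)"
      by (auto simp: compose_def case_prod_unfold)
    have "(\<lambda>u\<in>U. (\<lambda>u\<in>U. ?p u \<oplus>\<^bsub>L\<^esub> ?q u) u x) \<in> plots (FO x) n U" if x: "x \<in> Obj J" for x
    proof -
      interpret diffeological_vector_space "FO x" using dvs_FO x .
      have "(\<lambda>u\<in>U. (\<lambda>u\<in>U. ?p u \<oplus>\<^bsub>L\<^esub> ?q u) u x)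
          = (\<lambda>u\<in>U. (\<lambda>u\<in>U. ?p u x) u \<oplus>\<^bsub>FO x\<^esub> (\<lambda>u\<in>U. ?q u x) u)"
        using x by (auto simp: ops_L)
      then show ?thesis
        using plot_add[OF component_plot[OF pq(1) x] component_plot[OF pq(2) x]] by simp
    qed
    moreover have "(\<lambda>u\<in>U. ?p u \<oplus>\<^bsub>L\<^esub> ?q u) \<in> U \<rightarrow>\<^sub>E carrier L" "openin (Euclidean_space n) U"
      using pq by (auto simp: plots_L intro!: add_closed_L)
    ultimately show "compose U (\<lambda>(s, t). s \<oplus>\<^bsub>L\<^esub> t) r \<in> plots L n U"
      unfolding eq plots_L by blast
  qed (auto simp: add_closed_L)
  show "smooth_map (UNIV \<times> carrier L) (prod_plots real_plots (plots L))
          (carrier L) (plots L) (\<lambda>(a, s). a \<odot>\<^bsub>L\<^esub> s)"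
    unfolding smooth_map_def
  proof (intro conjI allI ballI)
    fix n U r assume r: "r \<in> prod_plots real_plots (plots L) n U"
    let ?c = "compose U fst r" and ?p = "compose U snd r"
    have cp: "?c \<in> real_plots n U" "?p \<in> plots L n U"
      using r by (auto simp: prod_plots_def)
    have eq: "compose U (\<lambda>(a, s). a \<odot>\<^bsub>L\<^esub> s) r = (\<lambda>u\<in>U. ?c u \<odot>\<^bsub>L\<^esub> ?p u)"
      by (auto simp: compose_def case_prod_unfold)
    have "(\<lambda>u\<in>U. (\<lambda>u\<in>U. ?c u \<odot>\<^bsub>L\<^esub> ?p u) u x) \<in> plots (FO x) n U" if x: "x \<in> Obj J" for x
    proof -
      interpret diffeological_vector_space "FO x" using dvs_FO x .
      have "(\<lambda>u\<in>U. (\<lambda>u\<in>U. ?c u \<odot>\<^bsub>L\<^esub> ?p u) u x) = (\<lambda>u\<in>U. ?c u \<odot>\<^bsub>FO x\<^esub> (\<lambda>u\<in>U. ?p u x) u)"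
        using x by (auto simp: ops_L)
      then show ?thesis
        using plot_smult[OF cp(1) component_plot[OF cp(2) x]] by simp
    qed
    moreover have "(\<lambda>u\<in>U. ?c u \<odot>\<^bsub>L\<^esub> ?p u) \<in> U \<rightarrow>\<^sub>E carrier L" "openin (Euclidean_space n) U"
      using cp by (auto simp: plots_L intro!: smult_closed_L)
    ultimately show "compose U (\<lambda>(a, s). a \<odot>\<^bsub>L\<^esub> s) r \<in> plots L n U"
      unfolding eq plots_L by blast
  qed (auto simp: smult_closed_L)
qed (rule module_L diffeological_space_L)+

section \<open>Universal property of the space of compatible families\<close>

lemma cone_L: "DVect_cone J FO FM L \<pi>"
  unfolding DVect_cone_def
proof (intro conjI ballI)
  fix x assume x: "x \<in> Obj J"
  \<comment> \<open>The composite with a projection is exactly the component that the definition of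
    \<open>plots L\<close> requires to be a plot.\<close>
  have "compose U (\<pi> x) p = (\<lambda>u\<in>U. p u x)" if "p \<in> plots L n U" for n U p
    using that by (auto simp: plots_L compose_def limit_proj_def fun_eq_iff)
  then show "\<pi> x \<in> smooth_linear_maps L (FO x)"
    using x add_closed_L smult_closed_L
    by (auto simp: smooth_linear_maps_def smooth_map_def limit_proj_def component_plot
        component_closed ops_L)
next
  fix x y f assume "x \<in> Obj J" "y \<in> Obj J" "f \<in> Hom J x y"
  then show "compose (carrier L) (FM x y f) (\<pi> x) = \<pi> y"
    by (auto simp: limit_proj_def compose_def fun_eq_iff carrier_L)
qed (rule dvs_L)

definition tuple :: "'w dvs \<Rightarrow> ('o \<Rightarrow> 'w \<Rightarrow> 'v) \<Rightarrow> 'w \<Rightarrow> 'o \<Rightarrow> 'v" where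
  "tuple W q = (\<lambda>w\<in>carrier W. \<lambda>x\<in>Obj J. q x w)"

text \<open>The cone equations say precisely that the values of the tuple are compatible families.
  Linearity and smoothness are tested on components, and the component at \<open>x\<close> is
  \<open>q x\<close>.\<close>

lemma tuple_smooth_linear:
  assumes cone: "DVect_cone J FO FM W q"
  shows "tuple W q \<in> smooth_linear_maps W L"
proof -
  interpret W: diffeological_vector_space W using cone by (simp add: DVect_cone_def)
  have q: "q x \<in> smooth_linear_maps W (FO x)" if "x \<in> Obj J" for x
    using cone that by (simp add: DVect_cone_def)
  have compat: "FM x y f (q x w) = q y w"
    if "x \<in> Obj J" "y \<in> Obj J" "f \<in> Hom J x y" "w \<in> carrier W" for x y f w
  proof -
    have "compose (carrier W) (FM x y f) (q x) = q y"
      using cone that by (simp add: DVect_cone_def)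
    then show ?thesis using compose_eq[OF that(4), of "FM x y f" "q x"] by simp
  qed
  have smult: "a \<odot>\<^bsub>W\<^esub> w \<in> carrier W" if "w \<in> carrier W" for a w
    using that by simp
  have closed: "tuple W q \<in> carrier W \<rightarrow>\<^sub>E carrier L"
    using q compat by (fastforce simp: tuple_def carrier_L smooth_linear_maps_def)
  have "compose U (tuple W q) p \<in> plots L n U" if p: "p \<in> plots W n U" for n U p
  proof -
    have pU: "openin (Euclidean_space n) U" "p \<in> U \<rightarrow>\<^sub>E carrier W" using W.plotD[OF p] by auto
    have "(\<lambda>u\<in>U. compose U (tuple W q) p u x) \<in> plots (FO x) n U" if x: "x \<in> Obj J" for x
    proof -
      have "(\<lambda>u\<in>U. compose U (tuple W q) p u x) = compose U (q x) p"
        using pU x by (auto simp: compose_def tuple_def fun_eq_iff)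
      then show ?thesis
        using q[OF x] p by (simp add: smooth_linear_maps_def smooth_map_def)
    qed
    moreover have "compose U (tuple W q) p \<in> U \<rightarrow>\<^sub>E carrier L"
      using closed pU by (auto simp: compose_def)
    ultimately show ?thesis using pU by (simp add: plots_L)
  qed
  moreover have "tuple W q (v \<oplus>\<^bsub>W\<^esub> w) = tuple W q v \<oplus>\<^bsub>L\<^esub> tuple W q w"
    if "v \<in> carrier W" "w \<in> carrier W" for v w
    using that q by (auto simp: tuple_def ops_L smooth_linear_maps_def)
  moreover have "tuple W q (a \<odot>\<^bsub>W\<^esub> w) = a \<odot>\<^bsub>L\<^esub> tuple W q w" if "w \<in> carrier W" for a w
    using that q smult by (auto simp: tuple_def ops_L smooth_linear_maps_def)
  ultimately show ?thesis
    using closed by (auto simp: smooth_linear_maps_def smooth_map_def)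
qed

text \<open>The type \<open>'w\<close> stays free, so the same pair can later be tested both over
  its own type and over an arbitrary one.\<close>

lemma limit_L: "DVect_limit TYPE('w) J FO FM L \<pi>"
  unfolding DVect_limit_def
proof (intro conjI allI impI cone_L)
  fix W :: "'w dvs" and q assume cone: "DVect_cone J FO FM W q"
  have q: "q x \<in> carrier W \<rightarrow>\<^sub>E carrier (FO x)" if "x \<in> Obj J" for x
    using cone that by (simp add: DVect_cone_def smooth_linear_maps_def)
  have tuple_L: "tuple W q w \<in> carrier L" if "w \<in> carrier W" for w
    using tuple_smooth_linear[OF cone] that by (auto simp: smooth_linear_maps_def)
  show "\<exists>!h. h \<in> smooth_linear_maps W L \<and> (\<forall>x\<in>Obj J. compose (carrier W) (\<pi> x) h = q x)"
  proof (intro ex1I conjI ballI)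
    show "tuple W q \<in> smooth_linear_maps W L" using cone by (rule tuple_smooth_linear)
    show "compose (carrier W) (\<pi> x) (tuple W q) = q x" if "x \<in> Obj J" for x
    proof (rule extensionalityI)
      show "compose (carrier W) (\<pi> x) (tuple W q) w = q x w" if "w \<in> carrier W" for w
        using that \<open>x \<in> Obj J\<close> tuple_L[OF that]
        \<comment> \<open>\<open>tuple\<close> stays folded until the projection has been evaluated,
          which uses its membership in \<open>carrier L\<close>.\<close>
        by (simp add: compose_eq limit_proj_def) (simp add: tuple_def)
    qed (use q[OF that] in \<open>auto simp: PiE_def\<close>)
  next
    fix h assume h: "h \<in> smooth_linear_maps W L \<and>
      (\<forall>x\<in>Obj J. compose (carrier W) (\<pi> x) h = q x)"
    then have h_PiE: "h \<in> carrier W \<rightarrow>\<^sub>E carrier L" by (simp add: smooth_linear_maps_def)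
    show "h = tuple W q"
    proof (rule extensionalityI)
      fix w assume w: "w \<in> carrier W"
      then have hw: "h w \<in> carrier L" using h_PiE by auto
      \<comment> \<open>The projection equations fix every coordinate over \<open>Obj J\<close>;
        elsewhere both families are undefined.\<close>
      have "h w x = q x w" if "x \<in> Obj J" for x
        using h that w hw compose_eq[OF w, of "\<pi> x" h] by (simp add: limit_proj_def)
      then show "h w = tuple W q w"
        using w hw by (auto simp: tuple_def carrier_L PiE_def extensional_def fun_eq_iff)
    qed (use h_PiE in \<open>auto simp: PiE_def tuple_def\<close>)
  qed
qed

end

section \<open>Limits over one type are limits for all types\<close>

lemma DVect_cone_compose:
  assumes "DVect_cone J FO FM L p" "diffeological_vector_space W" "h \<in> smooth_linear_maps W L"
  shows "DVect_cone J FO FM W (\<lambda>x. compose (carrier W) (p x) h)"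
proof -
  have h: "h w \<in> carrier L" if "w \<in> carrier W" for w
    using assms(3) that by (auto simp: smooth_linear_maps_def)
  have "compose (carrier W) (FM x y f) (compose (carrier W) (p x) h)
      = compose (carrier W) (compose (carrier L) (FM x y f) (p x)) h" for x y f
    using h by (auto simp: compose_def fun_eq_iff)
  then show ?thesis
    using assms by (auto simp: DVect_cone_def smooth_linear_maps_compose)
qed

text \<open>The projections of a limit are jointly monic: \<open>h\<close> and \<open>k\<close> both
  mediate the cone obtained by composing the projections with \<open>k\<close>.\<close>

lemma DVect_limit_unique:
  fixes W :: "'w dvs"
  assumes lim: "DVect_limit TYPE('w) J FO FM L p" and W: "diffeological_vector_space W"
    and h: "h \<in> smooth_linear_maps W L" and k: "k \<in> smooth_linear_maps W L"
    and eq: "\<And>x. x \<in> Obj J \<Longrightarrow> compose (carrier W) (p x) h = compose (carrier W) (p x) k"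
  shows "h = k"
proof -
  have "DVect_cone J FO FM L p" using lim by (simp add: DVect_limit_def)
  from DVect_cone_compose[OF this W k]
  have "\<exists>!h. h \<in> smooth_linear_maps W L \<and>
      (\<forall>x\<in>Obj J. compose (carrier W) (p x) h = compose (carrier W) (p x) k)"
    using lim by (simp add: DVect_limit_def)
  then show ?thesis using h k eq by blast
qed

text \<open>Composition of truncated functions associates here because \<open>h\<close> takes its
  values in \<open>carrier V\<close>.\<close>

lemma compose_assoc_maps:
  assumes "h \<in> smooth_linear_maps U V"
  shows "compose (carrier U) (compose (carrier V) f g) h
       = compose (carrier U) f (compose (carrier U) g h)"
  using assms by (auto simp: smooth_linear_maps_def compose_def fun_eq_iff)

text \<open>\<open>M\<close> and \<open>L\<close> have points in the same type \<open>'l\<close>, so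
  each is a vertex against which the other is tested. The resulting comparison maps carry the
  universal property over \<open>'w\<close> from \<open>M\<close> to \<open>L\<close>.\<close>

lemma DVect_limit_transfer:
  fixes L :: "'l dvs" and M :: "'l dvs"
  assumes M: "DVect_limit TYPE('l) J FO FM M r" "DVect_limit TYPE('w) J FO FM M r"
    and L: "DVect_limit TYPE('l) J FO FM L p"
  shows "DVect_limit TYPE('w) J FO FM L p"
proof -
  have coneM: "DVect_cone J FO FM M r" and coneL: "DVect_cone J FO FM L p"
    using M L by (auto simp: DVect_limit_def)
  then have dvs: "diffeological_vector_space M" "diffeological_vector_space L"
    by (auto simp: DVect_cone_def)
  obtain h where h: "h \<in> smooth_linear_maps L M"
    and rh: "\<And>x. x \<in> Obj J \<Longrightarrow> compose (carrier L) (r x) h = p x"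
    using M(1) coneL unfolding DVect_limit_def by blast
  obtain k where k: "k \<in> smooth_linear_maps M L"
    and pk: "\<And>x. x \<in> Obj J \<Longrightarrow> compose (carrier M) (p x) k = r x"
    using L coneM unfolding DVect_limit_def by blast
  \<comment> \<open>Both sides agree after every projection \<open>p x\<close>, hence they coincide.
    This makes \<open>L\<close> a retract of \<open>M\<close>, which is what uniqueness over
    \<open>'w\<close> rests on below.\<close>
  have kh: "compose (carrier L) k h = (\<lambda>v\<in>carrier L. v)"
  proof (rule DVect_limit_unique[OF L dvs(2)])
    fix x assume x: "x \<in> Obj J"
    have "p x \<in> extensional (carrier L)"
      using coneL x by (auto simp: DVect_cone_def smooth_linear_maps_def PiE_def)
    then have "compose (carrier L) (p x) (\<lambda>v\<in>carrier L. v) = p x"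
      by (auto simp: compose_def fun_eq_iff extensional_def)
    then show "compose (carrier L) (p x) (compose (carrier L) k h)
        = compose (carrier L) (p x) (\<lambda>v\<in>carrier L. v)"
      using compose_assoc_maps[OF h, of "p x" k] pk[OF x] rh[OF x] by simp
  qed (use smooth_linear_maps_compose[OF dvs(2) h k] smooth_linear_maps_id[OF dvs(2)] in auto)
  show ?thesis
    unfolding DVect_limit_def
  proof (intro conjI allI impI coneL)
    fix W :: "'w dvs" and q assume cone: "DVect_cone J FO FM W q"
    then have W: "diffeological_vector_space W" by (simp add: DVect_cone_def)
    obtain g where g: "g \<in> smooth_linear_maps W M"
      and rg: "\<And>x. x \<in> Obj J \<Longrightarrow> compose (carrier W) (r x) g = q x"
      using M(2) cone unfolding DVect_limit_def by blast
    show "\<exists>!f. f \<in> smooth_linear_maps W L \<and> (\<forall>x\<in>Obj J. compose (carrier W) (p x) f = q x)"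
    proof (intro ex1I conjI ballI)
      \<comment> \<open>The mediating map into \<open>L\<close> is the one into \<open>M\<close>
        followed by the comparison map \<open>k\<close>.\<close>
      show "compose (carrier W) k g \<in> smooth_linear_maps W L"
        using W g k by (rule smooth_linear_maps_compose)
      show "compose (carrier W) (p x) (compose (carrier W) k g) = q x" if "x \<in> Obj J" for x
        using compose_assoc_maps[OF g, of "p x" k] pk[OF that] rg[OF that] by simp
    next
      fix f assume "f \<in> smooth_linear_maps W L \<and> (\<forall>x\<in>Obj J. compose (carrier W) (p x) f = q x)"
      then have f: "f \<in> smooth_linear_maps W L"
        and pf: "\<And>x. x \<in> Obj J \<Longrightarrow> compose (carrier W) (p x) f = q x" by auto
      \<comment> \<open>Pushing a competitor \<open>f\<close> into \<open>M\<close> gives a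
        mediating map there, so it equals \<open>g\<close>. Applying \<open>k\<close> and using
        \<open>kh\<close> then recovers \<open>f\<close>.\<close>
      have "compose (carrier W) h f = g"
      proof (rule DVect_limit_unique[OF M(2) W])
        show "compose (carrier W) (r x) (compose (carrier W) h f) = compose (carrier W) (r x) g"
          if "x \<in> Obj J" for x
          using compose_assoc_maps[OF f, of "r x" h] rh[OF that] pf[OF that] rg[OF that] by simp
      qed (use smooth_linear_maps_compose[OF W f h] g in auto)
      then have "compose (carrier W) k g = compose (carrier W) (\<lambda>v\<in>carrier L. v) f"
        using compose_assoc_maps[OF f, of k h] kh by simp
      also have "\<dots> = f"
        using f by (auto simp: smooth_linear_maps_def compose_def fun_eq_iff PiE_def extensional_def)
      finally show "f = compose (carrier W) k g" by simp
    qed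
  qed
qed

theorem theorem3p1:
  fixes J :: "('o, 'm) category_data"
    and FO :: "'o \<Rightarrow> 'v dvs"
    and FM :: "'o \<Rightarrow> 'o \<Rightarrow> 'm \<Rightarrow> 'v \<Rightarrow> 'v"
  assumes "category J"
    and "cat_functor J DVect FO FM"
  shows "(\<exists>(L :: ('o \<Rightarrow> 'v) dvs) p. DVect_limit TYPE('o \<Rightarrow> 'v) J FO FM L p) \<and>
    (\<forall>(L :: ('o \<Rightarrow> 'v) dvs) p. DVect_limit TYPE('o \<Rightarrow> 'v) J FO FM L p \<longrightarrow>
       DVect_limit TYPE('w) J FO FM L p)"
proof -
  interpret DVect_diagram J FO FM
    using assms(2) by (rule DVect_diagram.intro)
  show ?thesis
    \<comment> \<open>The concrete limit plays the role of \<open>M\<close>: \<open>limit_L\<close>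
      is instantiated once at \<open>'o \<Rightarrow> 'v\<close> and once at
      \<open>'w\<close>.\<close>
    using limit_L DVect_limit_transfer[OF limit_L limit_L] by blast
qed

end
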